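(* Let $k\ge 1$ be an integer and let $p=p(n)\in(0,1)$ be a probability parameter which may depend on $n$. (a) If $p\ll n^{-1-\frac{2}{k+1}}$, then a random 2-complex $Y\in G(\Delta_n^{(2)},p)$ is collapsible to a graph in at most $k$ steps, asymptotically almost surely. (b) If $p\gg n^{-1-\frac{1}{3\cdot 2^{k-1}-1}}$, then a random 2-complex $Y\in G(\Delta_n^{(2)},p)$ is not collapsible to a graph in $k$ or fewer steps, asymptotically almost surely.
   Context: Random 2-complexes (Linial--Meshulam model): $\Delta_n$ is the $(n-1)$-dimensional simplex with vertex set $\{1,\dots,n\}$ and $\Delta_n^{(i)}$ is its $i$-skeleton. $G(\Delta_n^{(2)},p)$ is the set of all simplicial complexes $Y$ with $\Delta_n^{(1)}\subset Y\subset \Delta_n^{(2)}$, equipped with the probability function $\mathbb{P}(Y)=p^{f(Y)}(1-p)^{\binom n3-f(Y)}$, where $f(Y)$ is the number of 2-simplexes of $Y$ (each 2-simplex is included independently with probability $p$). "Asymptotically almost surely" (a.a.s.) means with probability tending to $1$ as $n\to\infty$. The symbol $a_n\ll b_n$ means $a_n>0$ and $a_n/b_n\to 0$ as $n\to\infty$; $a_n\gg b_n$ means $b_n\ll a_n$. Collapsing: let $Y$ be a finite simplicial complex of dimension at most 2. An edge of $Y$ is free if it is contained in exactly one 2-simplex of $Y$. A 2-simplex is free if at least one of its edges is free. Let $\sigma_1,\dots,\sigma_m$ be all the free 2-simplexes of $Y$ and choose a free edge $e_i\subset\sigma_i$ for each $i$. Put $Y'=Y-\bigcup_i \mathrm{int}(\sigma_i)-\bigcup_i\mathrm{int}(e_i)$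 (the set of 2-simplexes of $Y'$ does not depend on the choice of the $e_i$). Iterate: $Y^{(0)}=Y$, $Y^{(i+1)}=(Y^{(i)})'$. $Y$ is collapsible to a graph in at most $k$ steps (equivalently, in $k$ or fewer steps) if $Y^{(k)}$ is a graph, i.e. has no 2-simplexes. *)

theory Defs
  imports "HOL-Probability.Probability"
begin

section \<open>Finite abstract simplicial complexes\<close>

text \<open>
  A complex is identified with the set of its (nonempty) simplices, a simplex with its set of
  vertices; an \<open>i\<close>-simplex has \<open>i + 1\<close> vertices. (The constant \<^const>\<open>simplicial_complex\<close> of the
  library describes geometric complexes in a fixed Euclidean space.)
\<close>

definition abstract_complex :: "'a set set \<Rightarrow> bool" where
  "abstract_complex Y \<longleftrightarrow> finite Y \<and> (\<forall>s\<in>Y. finite s \<and> s \<noteq> {})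
     \<and> (\<forall>s\<in>Y. \<forall>t. t \<subseteq> s \<and> t \<noteq> {} \<longrightarrow> t \<in> Y)"

definition simplices :: "nat \<Rightarrow> 'a set set \<Rightarrow> 'a set set" where
  "simplices i Y = {s \<in> Y. card s = i + 1}"

definition skeleton :: "nat \<Rightarrow> 'a set set \<Rightarrow> 'a set set" where
  "skeleton i Y = {s \<in> Y. card s \<le> i + 1}"

definition full_simplex :: "nat \<Rightarrow> nat set set" where
  "full_simplex n = {s. s \<subseteq> {1..n} \<and> s \<noteq> {}}"


section \<open>Collapsing\<close>

definition free_edge :: "'a set set \<Rightarrow> 'a set \<Rightarrow> bool" where
  "free_edge Y e \<longleftrightarrow> e \<in> simplices 1 Y \<and> (\<exists>!s. s \<in> simplices 2 Y \<and> e \<subseteq> s)"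

definition free_triangles :: "'a set set \<Rightarrow> 'a set set" where
  "free_triangles Y = {s \<in> simplices 2 Y. \<exists>e. e \<subseteq> s \<and> free_edge Y e}"

text \<open>
  One round removes all free 2-simplices simultaneously, each together with one chosen free edge
  \<open>c s\<close>. As the choice is arbitrary, this is a relation; the 2-simplices of the result do not
  depend on the choice (see \<open>collapse_rounds_simplices\<close> below).
\<close>

definition collapse_round :: "'a set set \<Rightarrow> 'a set set \<Rightarrow> bool" where
  "collapse_round Y Y' \<longleftrightarrow>
     (\<exists>c. (\<forall>s\<in>free_triangles Y. c s \<subseteq> s \<and> free_edge Y (c s))
        \<and> Y' = Y - free_triangles Y - c ` free_triangles Y)"

definition collapsible_to_graph :: "nat \<Rightarrow> 'a set set \<Rightarrow> bool" where
  "collapsible_to_graph k Y \<longleftrightarrow> (\<exists>Z. (collapse_round ^^ k) Y Z \<and> simplices 2 Z = {})"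

lemma collapse_round_total: "\<exists>Y'. collapse_round Y Y'"
proof -
  have "\<forall>s\<in>free_triangles Y. \<exists>e. e \<subseteq> s \<and> free_edge Y e"
    by (auto simp: free_triangles_def)
  then show ?thesis
    unfolding collapse_round_def by (metis bchoice)
qed

lemma simplices_collapse_round:
  assumes "collapse_round Y Y'"
  shows "simplices 2 Y' = simplices 2 Y - free_triangles Y"
proof -
  obtain c where c: "\<forall>s\<in>free_triangles Y. c s \<subseteq> s \<and> free_edge Y (c s)"
    "Y' = Y - free_triangles Y - c ` free_triangles Y"
    using assms by (auto simp: collapse_round_def)
  have "card (c s) = 2" if "s \<in> free_triangles Y" for s
    using c(1) that by (auto simp: free_edge_def simplices_def)
  then show ?thesis
    using c(2) by (fastforce simp: simplices_def)
qed

lemma abstract_complex_collapse_round: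
  assumes "abstract_complex Y" "\<forall>s\<in>Y. card s \<le> 3" "collapse_round Y Y'"
  shows "abstract_complex Y'" "\<forall>s\<in>Y'. card s \<le> 3"
proof -
  obtain c where c: "\<And>s. s \<in> free_triangles Y \<Longrightarrow> c s \<subseteq> s \<and> free_edge Y (c s)"
    "Y' = Y - free_triangles Y - c ` free_triangles Y"
    using assms(3) by (auto simp: collapse_round_def)
  have down: "t \<in> Y'" if s: "s \<in> Y'" and t: "t \<subseteq> s" "t \<noteq> {}" for s t
  proof (cases "t = s")
    case False
    have sY: "s \<in> Y" "finite s" "card s \<le> 3"
      using s c(2) assms(1,2) by (simp_all add: abstract_complex_def)
    have tY: "t \<in> Y"
      using sY(1) t assms(1) unfolding abstract_complex_def by blast
    have lt: "card t < card s"
      using False t sY(2) by (meson psubsetI psubset_card_mono)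
    have "t \<notin> free_triangles Y"
      using lt sY(3) by (auto simp: free_triangles_def simplices_def)
    moreover have "t \<notin> c ` free_triangles Y"
    proof
      assume "t \<in> c ` free_triangles Y"
      then obtain u where u: "u \<in> free_triangles Y" "t = c u" by auto
      have f: "free_edge Y t" "t \<subseteq> u" using c(1)[OF u(1)] u(2) by auto
      then have "card t = 2" by (auto simp: free_edge_def simplices_def)
      then have "s \<in> simplices 2 Y" using lt sY by (auto simp: simplices_def)
      moreover have "u \<in> simplices 2 Y" using u(1) by (auto simp: free_triangles_def)
      ultimately have "s = u" using f t(1) unfolding free_edge_def by blast
      then show False using s u(1) c(2) by auto
    qed
    ultimately show ?thesis using tY c(2) by auto
  qed (use s in auto)
  show "abstract_complex Y'"
    unfolding abstract_complex_def
  proof (intro conjI ballI allI impI)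
    show "finite Y'" using assms(1) c(2) by (simp add: abstract_complex_def)
    show "finite s" "s \<noteq> {}" if "s \<in> Y'" for s
      using that assms(1) c(2) by (simp_all add: abstract_complex_def)
    show "t \<in> Y'" if "s \<in> Y'" "t \<subseteq> s \<and> t \<noteq> {}" for s t
      using that down by blast
  qed
  show "\<forall>s\<in>Y'. card s \<le> 3"
    using assms(2) c(2) by auto
qed

lemma free_triangles_cong:
  assumes "abstract_complex Y" "abstract_complex Z" "simplices 2 Y = simplices 2 Z"
  shows "free_triangles Y = free_triangles Z"
proof -
  have *: "e \<in> simplices 1 W \<longleftrightarrow> card e = 2"
    if "abstract_complex W" "s \<in> simplices 2 W" "e \<subseteq> s" for W :: "'a set set" and s e
  proof -
    have "e \<in> W" if "card e = 2"
    proof -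
      have "e \<noteq> {}" using that by auto
      then show ?thesis
        using \<open>abstract_complex W\<close> \<open>s \<in> simplices 2 W\<close> \<open>e \<subseteq> s\<close>
        unfolding abstract_complex_def simplices_def by blast
    qed
    then show ?thesis by (auto simp: simplices_def)
  qed
  have "free_edge Y e \<longleftrightarrow> free_edge Z e" for e
  proof (cases "\<exists>s. s \<in> simplices 2 Y \<and> e \<subseteq> s")
    case True
    then obtain s where s: "s \<in> simplices 2 Y" "s \<in> simplices 2 Z" "e \<subseteq> s"
      using assms(3) by auto
    show ?thesis
      using *[OF assms(1) s(1,3)] *[OF assms(2) s(2,3)] assms(3) by (simp add: free_edge_def)
  next
    case False
    then show ?thesis using assms(3) by (auto simp: free_edge_def)
  qed
  then show ?thesis using assms(3) by (auto simp: free_triangles_def)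
qed

lemma collapse_rounds_simplices:
  assumes "abstract_complex Y" "\<forall>s\<in>Y. card s \<le> 3"
    and "(collapse_round ^^ k) Y Z" "(collapse_round ^^ k) Y Z'"
  shows "simplices 2 Z = simplices 2 Z'"
proof -
  have inv: "abstract_complex W \<and> (\<forall>s\<in>W. card s \<le> 3)" if "(collapse_round ^^ k) Y W" for k W
    using that
  proof (induction k arbitrary: W)
    case (Suc k)
    obtain V where V: "(collapse_round ^^ k) Y V" "collapse_round V W"
      using Suc.prems by (rule relpowp_Suc_E)
    then show ?case using Suc.IH[OF V(1)] abstract_complex_collapse_round[of V W] by blast
  qed (use assms(1,2) in auto)
  show ?thesis using assms(3,4)
  proof (induction k arbitrary: Z Z')
    case (Suc k)
    obtain W where W: "(collapse_round ^^ k) Y W" "collapse_round W Z"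
      using Suc.prems(1) by (rule relpowp_Suc_E)
    obtain W' where W': "(collapse_round ^^ k) Y W'" "collapse_round W' Z'"
      using Suc.prems(2) by (rule relpowp_Suc_E)
    have eq: "simplices 2 W = simplices 2 W'" using Suc.IH[OF W(1) W'(1)] .
    then have "free_triangles W = free_triangles W'"
      using free_triangles_cong[of W W'] inv[OF W(1)] inv[OF W'(1)] by simp
    then show ?case
      using eq simplices_collapse_round[OF W(2)] simplices_collapse_round[OF W'(2)] by simp
  qed auto
qed


section \<open>The Linial--Meshulam model\<close>

definition lm_complexes :: "nat \<Rightarrow> nat set set set" where
  "lm_complexes n = {Y. abstract_complex Y \<and>
     skeleton 1 (full_simplex n) \<subseteq> Y \<and> Y \<subseteq> skeleton 2 (full_simplex n)}"

definition lm_model :: "nat \<Rightarrow> real \<Rightarrow> nat set set measure" where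
  "lm_model n p = point_measure (lm_complexes n)
     (\<lambda>Y. ennreal (p ^ card (simplices 2 Y) * (1 - p) ^ ((n choose 3) - card (simplices 2 Y))))"

lemma space_lm_model [simp]: "space (lm_model n p) = lm_complexes n"
  by (simp add: lm_model_def space_point_measure)

lemma sets_lm_model [simp]: "sets (lm_model n p) = Pow (lm_complexes n)"
  by (simp add: lm_model_def sets_point_measure)

lemma finite_full_simplex: "finite (full_simplex n)"
  by (rule finite_subset[of _ "Pow {1..n}"]) (auto simp: full_simplex_def)

lemma finite_lm_complexes: "finite (lm_complexes n)"
  by (rule finite_subset[of _ "Pow (full_simplex n)"])
     (auto simp: lm_complexes_def skeleton_def finite_full_simplex)

lemma card_triangles_full_simplex: "card (simplices 2 (full_simplex n)) = n choose 3"
proof -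
  have "simplices 2 (full_simplex n) = {s. s \<subseteq> {1..n} \<and> card s = 3}"
    by (auto simp: simplices_def full_simplex_def)
  then show ?thesis by (simp add: n_subsets)
qed

lemma bij_betw_lm_complexes:
  "bij_betw (simplices 2) (lm_complexes n) (Pow (simplices 2 (full_simplex n)))"
proof (rule bij_betw_byWitness[where f' = "\<lambda>T. skeleton 1 (full_simplex n) \<union> T"])
  have fin: "finite s" if "s \<in> full_simplex n" for s
    using that by (auto simp: full_simplex_def intro: finite_subset)
  show "\<forall>Y\<in>lm_complexes n. skeleton 1 (full_simplex n) \<union> simplices 2 Y = Y"
    by (force simp: lm_complexes_def skeleton_def simplices_def)
  show "\<forall>T\<in>Pow (simplices 2 (full_simplex n)).
      simplices 2 (skeleton 1 (full_simplex n) \<union> T) = T"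
    by (auto simp: skeleton_def simplices_def)
  show "simplices 2 ` lm_complexes n \<subseteq> Pow (simplices 2 (full_simplex n))"
    by (auto simp: lm_complexes_def skeleton_def simplices_def)
  show "(\<lambda>T. skeleton 1 (full_simplex n) \<union> T) ` Pow (simplices 2 (full_simplex n))
      \<subseteq> lm_complexes n"
  proof clarify
    fix T assume T: "T \<subseteq> simplices 2 (full_simplex n)"
    let ?Y = "skeleton 1 (full_simplex n) \<union> T"
    have sub: "?Y \<subseteq> skeleton 2 (full_simplex n)"
      using T by (auto simp: skeleton_def simplices_def)
    have "t \<in> ?Y" if s: "s \<in> ?Y" and t: "t \<subseteq> s" "t \<noteq> {}" for s t
    proof (cases "t = s")
      case False
      have sf: "s \<in> full_simplex n" "card s \<le> 3"
        using s sub by (auto simp: skeleton_def)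
      then have "card t < card s"
        using False t fin by (meson psubsetI psubset_card_mono)
      moreover have "t \<in> full_simplex n" using sf t by (auto simp: full_simplex_def)
      ultimately show ?thesis using sf by (auto simp: skeleton_def)
    qed (use s in auto)
    moreover have "finite ?Y"
      by (rule finite_subset[OF _ finite_full_simplex]) (use sub in \<open>auto simp: skeleton_def\<close>)
    moreover have "finite s \<and> s \<noteq> {}" if "s \<in> ?Y" for s
      using that sub fin by (auto simp: skeleton_def full_simplex_def)
    ultimately have "abstract_complex ?Y" unfolding abstract_complex_def by blast
    then show "?Y \<in> lm_complexes n" using sub by (auto simp: lm_complexes_def)
  qed
qed

lemma sum_Pow_binomial:
  fixes x y :: real
  assumes "finite A"
  shows "(\<Sum>B\<in>Pow A. x ^ card B * y ^ (card A - card B)) = (x + y) ^ card A"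
proof -
  have "(\<Sum>B\<in>Pow A. x ^ card B * y ^ (card A - card B)) =
      (\<Sum>i\<le>card A. \<Sum>B | B \<in> Pow A \<and> card B = i. x ^ card B * y ^ (card A - card B))"
    by (rule sum.group[symmetric]) (use assms in \<open>auto intro: card_mono\<close>)
  also have "\<dots> = (\<Sum>i\<le>card A. of_nat (card A choose i) * x ^ i * y ^ (card A - i))"
    using assms by (intro sum.cong) (auto simp: n_subsets)
  also have "\<dots> = (x + y) ^ card A" by (simp add: binomial_ring)
  finally show ?thesis .
qed

lemma prob_space_lm_model:
  assumes "0 \<le> p" "p \<le> 1"
  shows "prob_space (lm_model n p)"
  unfolding lm_model_def
proof (rule prob_space_point_measure)
  have "(\<Sum>Y\<in>lm_complexes n. p ^ card (simplices 2 Y) *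
        (1 - p) ^ ((n choose 3) - card (simplices 2 Y))) =
      (\<Sum>T\<in>Pow (simplices 2 (full_simplex n)). p ^ card T * (1 - p) ^ ((n choose 3) - card T))"
    by (rule sum.reindex_bij_betw[OF bij_betw_lm_complexes])
  also have "\<dots> = 1"
  proof -
    have "finite (simplices 2 (full_simplex n))"
      by (simp add: simplices_def finite_full_simplex)
    from sum_Pow_binomial[OF this, of p "1 - p"] show ?thesis
      by (simp add: card_triangles_full_simplex)
  qed
  finally have *: "(\<Sum>Y\<in>lm_complexes n. p ^ card (simplices 2 Y) *
        (1 - p) ^ ((n choose 3) - card (simplices 2 Y))) = 1" .
  have "(\<Sum>Y\<in>lm_complexes n. ennreal (p ^ card (simplices 2 Y) *
        (1 - p) ^ ((n choose 3) - card (simplices 2 Y)))) =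
      ennreal (\<Sum>Y\<in>lm_complexes n. p ^ card (simplices 2 Y) *
        (1 - p) ^ ((n choose 3) - card (simplices 2 Y)))"
    by (rule sum_ennreal) (use assms in auto)
  then show "(\<Sum>Y\<in>lm_complexes n. ennreal (p ^ card (simplices 2 Y) *
        (1 - p) ^ ((n choose 3) - card (simplices 2 Y)))) = 1"
    by (simp add: *)
qed (use assms finite_lm_complexes in auto)

definition lm_aas :: "(nat \<Rightarrow> real) \<Rightarrow> (nat set set \<Rightarrow> bool) \<Rightarrow> bool" where
  "lm_aas p P \<longleftrightarrow> (\<lambda>n. \<P>(Y in lm_model n (p n). P Y)) \<longlonglongrightarrow> 1"

text \<open>Positivity is only required for \<open>n \<ge> 1\<close>, since \<open>0 powr a = 0\<close>.\<close>

definition much_less :: "(nat \<Rightarrow> real) \<Rightarrow> (nat \<Rightarrow> real) \<Rightarrow> bool" where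
  "much_less a b \<longleftrightarrow> (\<forall>n\<ge>1. a n > 0) \<and> (\<lambda>n. a n / b n) \<longlonglongrightarrow> 0"

end

theory Submission
  imports Defs
begin

text \<open>
  On the set of 2-simplices, one round of collapsing keeps exactly the triangles all of whose edges
  lie in another triangle.

  (a) Let a triangle survive \<open>k\<close> rounds. Either its strongly connected component has more than \<open>k\<close>
  triangles and so contains \<open>k + 1\<close> triangles on at most \<open>k + 3\<close> vertices, or the rounds become
  stationary on the component, leaving \<open>f \<le> k\<close> triangles without a free edge; then each vertex
  lies in at least three of them, so there are at most \<open>f\<close> vertices. By the union bound this has
  probability of order at most \<open>n ^ (k + 3) * p ^ (k + 1)\<close> plus the sum of \<open>(n * p) ^ f\<close>
  over \<open>1 \<le> f \<le> k\<close>.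

  (b) The complex obtained from a triangle by \<open>k\<close> times gluing a new triangle to every boundary edge
  has \<open>3 * 2 ^ k\<close> vertices and \<open>3 * 2 ^ k - 2\<close> triangles, and it keeps its central triangle for \<open>k\<close>
  rounds. Any \<open>f \<ge> 1\<close> of its triangles span at least \<open>f + 2\<close> vertices, so the second moment method
  yields a copy of it in \<open>Y\<close>.
\<close>

section \<open>Collapsing on the set of triangles\<close>

definition core_step :: "'a set set \<Rightarrow> 'a set set" where
  "core_step T = {s \<in> T. \<forall>e\<subseteq>s. card e = 2 \<longrightarrow> (\<exists>s'\<in>T. s' \<noteq> s \<and> e \<subseteq> s')}"

lemma simplices_collapse_round_eq_core_step:
  assumes "abstract_complex Y" "collapse_round Y Y'"
  shows "simplices 2 Y' = core_step (simplices 2 Y)"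
proof -
  have free: "free_edge Y e \<longleftrightarrow> card e = 2 \<and> (\<forall>s'\<in>simplices 2 Y. e \<subseteq> s' \<longrightarrow> s' = s)"
    if s: "s \<in> simplices 2 Y" "e \<subseteq> s" for s e
  proof -
    have "e \<in> simplices 1 Y \<longleftrightarrow> card e = 2"
    proof
      assume "card e = 2"
      moreover from this have "e \<noteq> {}" by auto
      ultimately show "e \<in> simplices 1 Y"
        using assms(1) s unfolding abstract_complex_def simplices_def by auto
    qed (auto simp: simplices_def)
    then show ?thesis using s unfolding free_edge_def by blast
  qed
  have "s \<in> free_triangles Y \<longleftrightarrow> s \<notin> core_step (simplices 2 Y)"
    if s: "s \<in> simplices 2 Y" for s
  proof -
    have "(\<exists>e. e \<subseteq> s \<and> free_edge Y e) \<longleftrightarrow>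
        (\<exists>e. e \<subseteq> s \<and> card e = 2 \<and> (\<forall>s'\<in>simplices 2 Y. e \<subseteq> s' \<longrightarrow> s' = s))"
      by (intro ex_cong1 conj_cong refl free[OF s])
    then show ?thesis
      unfolding free_triangles_def core_step_def mem_Collect_eq using s by metis
  qed
  moreover have "core_step (simplices 2 Y) \<subseteq> simplices 2 Y"
    by (auto simp: core_step_def)
  ultimately show ?thesis
    unfolding simplices_collapse_round[OF assms(2)] by blast
qed

lemma collapsible_to_graph_iff_core_step:
  assumes "abstract_complex Y" "\<forall>s\<in>Y. card s \<le> 3"
  shows "collapsible_to_graph k Y \<longleftrightarrow> (core_step ^^ k) (simplices 2 Y) = {}"
proof -
  have inv: "abstract_complex W \<and> (\<forall>s\<in>W. card s \<le> 3) \<and>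
      simplices 2 W = (core_step ^^ k) (simplices 2 Y)"
    if "(collapse_round ^^ k) Y W" for k W
    using that
  proof (induction k arbitrary: W)
    case (Suc k)
    obtain V where V: "(collapse_round ^^ k) Y V" "collapse_round V W"
      using Suc.prems by (rule relpowp_Suc_E)
    then show ?case
      using Suc.IH[OF V(1)] abstract_complex_collapse_round[of V W]
        simplices_collapse_round_eq_core_step[of V W] by simp
  qed (use assms in auto)
  have "\<exists>Z. (collapse_round ^^ k) Y Z"
  proof (induction k)
    case (Suc k)
    then show ?case using collapse_round_total by (metis relpowp_Suc_I)
  qed auto
  then show ?thesis unfolding collapsible_to_graph_def using inv by metis
qed

lemma funpow_core_step_subset: "i \<le> j \<Longrightarrow> (core_step ^^ j) T \<subseteq> (core_step ^^ i) T"
  by (induction rule: dec_induct) (auto simp: core_step_def)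

lemma card_Union_le_if_subset_core_step:
  assumes "finite D" and D3: "\<forall>s\<in>D. card s = 3" and core: "D \<subseteq> core_step D"
  shows "card (\<Union>D) \<le> card D"
proof -
  have fin: "finite s" if "s \<in> D" for s
    using D3 that card.infinite by fastforce
  have "3 \<le> card {s \<in> D. w \<in> s}" if "w \<in> \<Union>D" for w
  proof -
    obtain s where s: "s \<in> D" "w \<in> s" using \<open>w \<in> \<Union>D\<close> by auto
    have "card (s - {w}) = 2" using s D3 fin by auto
    then obtain a b where ab: "s - {w} = {a, b}" "a \<noteq> b" by (meson card_2_iff)
    then have sw: "s = {a, b, w}" "a \<noteq> w" "b \<noteq> w" using s by auto
    have other: "\<exists>t\<in>D. t \<noteq> s \<and> {x, w} \<subseteq> t" if "x \<in> {a, b}" for x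
      proof -
      have "{x, w} \<subseteq> s" "card {x, w} = 2" using that sw by auto
      then show ?thesis using core s(1) unfolding core_step_def by blast
    qed
    obtain t where t: "t \<in> D" "t \<noteq> s" "{a, w} \<subseteq> t" using other[of a] by auto
    obtain u where u: "u \<in> D" "u \<noteq> s" "{b, w} \<subseteq> u" using other[of b] by auto
    have "t \<noteq> u"
    proof
      assume "t = u"
      then have "s \<subseteq> t" using t u sw by auto
      then show False using t s D3 fin by (metis card_subset_eq)
    qed
    then have "card {s, t, u} = 3" using t u by auto
    moreover have "{s, t, u} \<subseteq> {s \<in> D. w \<in> s}" using s t u by auto
    ultimately show ?thesis
      using card_mono[of "{s \<in> D. w \<in> s}" "{s, t, u}"] \<open>finite D\<close> by auto
  qed
  then have "3 * card (\<Union>D) \<le> (\<Sum>w\<in>\<Union>D. card {s \<in> D. w \<in> s})"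
    using sum_mono[of "\<Union>D" "\<lambda>_. 3" "\<lambda>w. card {s \<in> D. w \<in> s}"] by simp
  also have "\<dots> = (\<Sum>s\<in>D. card {w \<in> \<Union>D. w \<in> s})"
    using sum_multicount_gen[of "\<Union>D" D "\<lambda>w s. w \<in> s" "\<lambda>s. card {w \<in> \<Union>D. w \<in> s}"]
      \<open>finite D\<close> fin by auto
  also have "\<dots> = (\<Sum>s\<in>D. 3)"
  proof (intro sum.cong refl)
    fix s assume "s \<in> D"
    then have "{w \<in> \<Union>D. w \<in> s} = s" by auto
    then show "card {w \<in> \<Union>D. w \<in> s} = 3" using D3 \<open>s \<in> D\<close> by auto
  qed
  finally show ?thesis by simp
qed

text \<open>
  Growing a set of triangles from \<open>s\<close> along shared edges adds at most one vertex per triangle,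
  and can only stop at a set closed under adjacency.
\<close>

lemma grow_strongly_connected:
  assumes "finite T" and T3: "\<forall>s\<in>T. card s = 3" and "s \<in> T"
  shows "(\<exists>S\<subseteq>T. card S = m + 1 \<and> card (\<Union>S) \<le> m + 3) \<or>
    (\<exists>S\<subseteq>T. s \<in> S \<and> card S \<le> m \<and> (\<forall>t\<in>S. \<forall>e\<subseteq>t. \<forall>u\<in>T. card e = 2 \<longrightarrow> e \<subseteq> u \<longrightarrow> u \<in> S))"
    (is "_ \<or> ?closed m")
proof -
  have "(\<exists>S\<subseteq>T. s \<in> S \<and> card S = m + 1 \<and> card (\<Union>S) \<le> m + 3) \<or> ?closed m"
  proof (induction m)
    case 0
    show ?case using assms by (intro disjI1 exI[of _ "{s}"]) auto
  next
    case (Suc m)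
    show ?case
    proof (cases "?closed (Suc m)")
      case False
      then have "\<not> ?closed m" by (meson le_SucI)
      then obtain S where S: "S \<subseteq> T" "s \<in> S" "card S = m + 1" "card (\<Union>S) \<le> m + 3"
        using Suc.IH by blast
      then obtain t e u where e: "t \<in> S" "e \<subseteq> t" "u \<in> T" "card e = 2" "e \<subseteq> u" "u \<notin> S"
        using False by (auto simp: le_Suc_eq)
      have finT: "finite t" if "t \<in> T" for t
        using T3 that card.infinite by fastforce
      have fin: "finite S" "finite e" "finite u"
        using S \<open>finite T\<close> finite_subset e finT by (blast, blast, blast)
      have "\<Union>(insert u S) = \<Union>S \<union> (u - e)" using e(1,2) by auto
      then have "card (\<Union>(insert u S)) \<le> card (\<Union>S) + card (u - e)"
        using card_Un_le by metis
      also have "card (u - e) = 1" using e T3 fin by (simp add: card_Diff_subset)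
      finally have "card (\<Union>(insert u S)) \<le> Suc m + 3" using S by simp
      then show ?thesis
        using S e(3,6) fin by (intro disjI1 exI[of _ "insert u S"]) simp
    qed auto
  qed
  then show ?thesis by blast
qed

lemma dense_subset_if_core_step_nonempty:
  assumes "finite T" and T3: "\<forall>s\<in>T. card s = 3" and ne: "(core_step ^^ k) T \<noteq> {}"
  shows "\<exists>S\<subseteq>T. card S = k + 1 \<and> card (\<Union>S) \<le> k + 3 \<or>
    1 \<le> card S \<and> card S \<le> k \<and> card (\<Union>S) \<le> card S"
proof -
  obtain s where s: "s \<in> (core_step ^^ k) T" using ne by auto
  then have "s \<in> T" using funpow_core_step_subset[of 0 k T] by auto
  from grow_strongly_connected[OF assms(1,2) this, of k] show ?thesis
  proof
    assume "\<exists>S\<subseteq>T. s \<in> S \<and> card S \<le> k \<and>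
      (\<forall>t\<in>S. \<forall>e\<subseteq>t. \<forall>u\<in>T. card e = 2 \<longrightarrow> e \<subseteq> u \<longrightarrow> u \<in> S)"
    then obtain C where C: "C \<subseteq> T" "s \<in> C" "card C \<le> k"
      "\<forall>t\<in>C. \<forall>e\<subseteq>t. \<forall>u\<in>T. card e = 2 \<longrightarrow> e \<subseteq> u \<longrightarrow> u \<in> C"
      by (elim exE conjE)
    have closed: "u \<in> C" if "t \<in> C" "e \<subseteq> t" "u \<in> T" "card e = 2" "e \<subseteq> u" for t e u
      using C(4) that by simp
    have finC: "finite C" using C(1) \<open>finite T\<close> by (rule finite_subset)
    define D where "D i = C \<inter> (core_step ^^ i) T" for i
    have sD: "s \<in> D i" if "i \<le> k" for i
      using s C(2) funpow_core_step_subset[OF that, of T] by (auto simp: D_def)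
    have "\<exists>i<k. D i \<subseteq> D (Suc i)"
    proof (rule ccontr)
      assume "\<not> ?thesis"
      moreover have "D (Suc i) \<subseteq> D i" for i
        by (auto simp: D_def core_step_def)
      ultimately have lt: "D (Suc i) \<subset> D i" if "i < k" for i
        using that by blast
      have "card (D i) + i \<le> k" if "i \<le> k" for i
        using that
      proof (induction i)
        case 0
        have "card (D 0) \<le> card C" using finC by (auto simp: D_def intro: card_mono)
        then show ?case using C(3) by simp
      next
        case (Suc i)
        then have "card (D (Suc i)) < card (D i)"
          using lt[of i] finC by (intro psubset_card_mono) (auto simp: D_def)
        then show ?case using Suc by simp
      qed
      from this[of k] have "card (D k) = 0" by simp
      then show False using sD[of k] finC by (auto simp: D_def)
    qed
    then obtain i where i: "i < k" "D i \<subseteq> D (Suc i)" by blast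
    have sub: "D i \<subseteq> T" using C(1) by (auto simp: D_def)
    have "D i \<subseteq> core_step (D i)"
    proof
      fix t assume t: "t \<in> D i"
      then have t': "t \<in> C" "t \<in> core_step ((core_step ^^ i) T)"
        using i by (auto simp: D_def)
      have "\<exists>u\<in>D i. u \<noteq> t \<and> e \<subseteq> u" if e: "e \<subseteq> t" "card e = 2" for e
      proof -
        obtain u where u: "u \<in> (core_step ^^ i) T" "u \<noteq> t" "e \<subseteq> u"
          using t'(2) e unfolding core_step_def by blast
        moreover have "u \<in> T" using u funpow_core_step_subset[of 0 i T] by auto
        ultimately have "u \<in> D i"
          using closed[OF t'(1) e(1) _ e(2)] by (simp add: D_def)
        then show ?thesis using u by blast
      qed
      then show "t \<in> core_step (D i)" using t by (auto simp: core_step_def)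
    qed
    moreover have "finite (D i)" using finC by (auto simp: D_def)
    ultimately have "card (\<Union>(D i)) \<le> card (D i)"
      using T3 sub by (intro card_Union_le_if_subset_core_step) auto
    moreover have "1 \<le> card (D i)"
      using sD[of i] i \<open>finite (D i)\<close>
      by (metis One_nat_def Suc_leI card_gt_0_iff empty_iff less_imp_le)
    moreover have "card (D i) \<le> k"
      using card_mono[OF finC, of "D i"] C(3) by (auto simp: D_def)
    ultimately show ?thesis using sub by (intro exI[of _ "D i"]) simp
  next
    assume "\<exists>S\<subseteq>T. card S = k + 1 \<and> card (\<Union>S) \<le> k + 3"
    then show ?thesis by (elim ex_forward) simp
  qed
qed


section \<open>A tree of triangles\<close>

text \<open>
  The tree-like complex of the second moment argument: triangle \<open>i \<ge> 2\<close> has the new vertex \<open>i\<close> and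
  is glued along the edge \<open>attach i\<close>. Triangles 3, 4, 5 are glued to the edges of the central
  triangle 2, and triangles \<open>2 * i\<close>, \<open>2 * i + 1\<close> to the two new edges of triangle \<open>i \<ge> 3\<close>, so that
  the triangles at distance at most \<open>k\<close> from the centre are those with \<open>2 \<le> i < 3 * 2 ^ k\<close>.
\<close>

fun attach :: "nat \<Rightarrow> nat \<times> nat" where
  "attach i = (if i \<le> 3 then (0, 1) else if i = 4 then (0, 2) else if i = 5 then (1, 2)
     else (if even i then fst (attach (i div 2)) else snd (attach (i div 2)), i div 2))"

declare attach.simps [simp del]

lemma attach_base: "attach 2 = (0, 1)" "attach 3 = (0, 1)" "attach 4 = (0, 2)" "attach 5 = (1, 2)"
  by (subst attach.simps; simp)+

lemma attach_rec:
  assumes "6 \<le> i"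
  shows "attach i =
    (if even i then fst (attach (i div 2)) else snd (attach (i div 2)), i div 2)"
  by (subst attach.simps) (use assms in simp)

definition tree_triangle :: "nat \<Rightarrow> nat set" where
  "tree_triangle i = {fst (attach i), snd (attach i), i}"

lemma attach_less:
  assumes "2 \<le> i"
  shows "fst (attach i) < snd (attach i)" "snd (attach i) < i"
proof -
  have "fst (attach i) < snd (attach i) \<and> snd (attach i) < i"
    using assms
  proof (induction i rule: less_induct)
    case (less i)
    show ?case
    proof (cases "i \<le> 5")
      case True
      then have "i = 2 \<or> i = 3 \<or> i = 4 \<or> i = 5" using less.prems by auto
      then show ?thesis by (auto simp: attach_base)
    next
      case False
      then have "fst (attach (i div 2)) < snd (attach (i div 2)) \<and> snd (attach (i div 2)) < i div 2"
        by (intro less.IH) auto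
      then show ?thesis using False attach_rec[of i] by auto
    qed
  qed
  then show "fst (attach i) < snd (attach i)" "snd (attach i) < i" by auto
qed

lemma attach_double:
  assumes "3 \<le> i"
  shows "attach (2 * i) = (fst (attach i), i)" "attach (2 * i + 1) = (snd (attach i), i)"
  using assms attach_rec[of "2 * i"] attach_rec[of "2 * i + 1"] by auto

lemma card_tree_triangle: "2 \<le> i \<Longrightarrow> card (tree_triangle i) = 3"
  using attach_less[of i] by (simp add: tree_triangle_def card_insert_if)

lemma tree_triangle_le: "2 \<le> i \<Longrightarrow> x \<in> tree_triangle i \<Longrightarrow> x \<le> i"
  using attach_less[of i] by (auto simp: tree_triangle_def)

lemma inj_on_tree_triangle: "inj_on tree_triangle {2..}"
proof (rule inj_onI)
  fix i j :: nat assume ij: "i \<in> {2..}" "j \<in> {2..}" "tree_triangle i = tree_triangle j"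
  have "i \<in> tree_triangle j" "j \<in> tree_triangle i"
    using ij(3) by (auto simp: tree_triangle_def)
  then show "i = j"
    using ij(1,2) tree_triangle_le[of i j] tree_triangle_le[of j i] by auto
qed

lemma tree_triangle_neighbour:
  assumes i: "2 \<le> i" and e: "e \<subseteq> tree_triangle i" "card e = 2"
  shows "\<exists>j. 2 \<le> j \<and> j \<le> 2 * i + 1 \<and> j \<noteq> i \<and> e \<subseteq> tree_triangle j"
proof -
  define a b where ab: "a = fst (attach i)" "b = snd (attach i)"
  have T: "tree_triangle i = {a, b, i}" by (simp add: tree_triangle_def ab)
  have lt: "a < b" "b < i" using attach_less[OF i] by (simp_all add: ab)
  obtain x y where xy: "e = {x, y}" "x \<noteq> y" using e(2) by (meson card_2_iff)
  have "x \<in> {a, b, i}" "y \<in> {a, b, i}" using e(1) xy T by auto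
  then consider "e = {a, b}" | "e = {a, i}" | "e = {b, i}" using xy by auto
  then show ?thesis
  proof cases
    case 1
    consider "i = 2" | "3 \<le> i" "i \<le> 5" | "6 \<le> i" using i by linarith
    then show ?thesis
    proof cases
      case 1
      then show ?thesis
        using \<open>e = {a, b}\<close>
        by (intro exI[of _ 3]) (auto simp: ab tree_triangle_def attach_base)
    next
      case 2
      then have "i = 3 \<or> i = 4 \<or> i = 5" by auto
      then show ?thesis
        using \<open>e = {a, b}\<close>
        by (intro exI[of _ 2]) (auto simp: ab tree_triangle_def attach_base)
    next
      case 3
      then show ?thesis
        using \<open>e = {a, b}\<close> attach_rec[of i]
        by (intro exI[of _ "i div 2"]) (auto simp: ab tree_triangle_def)
    qed
  next
    case 2
    show ?thesis
    proof (cases "i = 2")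
      case True
      then show ?thesis
        using 2 by (intro exI[of _ 4]) (auto simp: ab tree_triangle_def attach_base)
    next
      case False
      then show ?thesis
        using 2 i attach_double(1)[of i]
        by (intro exI[of _ "2 * i"]) (auto simp: ab tree_triangle_def)
    qed
  next
    case 3
    show ?thesis
    proof (cases "i = 2")
      case True
      then show ?thesis
        using 3 by (intro exI[of _ 5]) (auto simp: ab tree_triangle_def attach_base)
    next
      case False
      then show ?thesis
        using 3 i attach_double(2)[of i]
        by (intro exI[of _ "2 * i + 1"]) (auto simp: ab tree_triangle_def)
    qed
  qed
qed

lemma tree_survives_core_step:
  assumes inj: "inj_on g {..<3 * 2 ^ k}"
    and sub: "(\<lambda>i. g ` tree_triangle i) ` {2..<3 * 2 ^ k} \<subseteq> T"
    and "j \<le> k" "i \<in> {2..<3 * 2 ^ (k - j)}"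
  shows "g ` tree_triangle i \<in> (core_step ^^ j) T"
  using assms(3,4)
proof (induction j arbitrary: i)
  case 0
  then show ?case using sub by auto
next
  case (Suc j)
  define N :: nat where "N = 3 * 2 ^ (k - Suc j)"
  have kj: "3 * 2 ^ (k - j) = 2 * N"
    using Suc.prems(1) by (simp add: N_def Suc_diff_Suc[symmetric])
  have "2 * N \<le> 3 * 2 ^ k" unfolding kj[symmetric] by simp
  have i: "2 \<le> i" "i < N" using Suc.prems(2) by (auto simp: N_def)
  have IH: "g ` tree_triangle i \<in> (core_step ^^ j) T" if "2 \<le> i" "i < 2 * N" for i
    using Suc.IH[of i] that kj Suc.prems(1) by simp
  have V: "tree_triangle i \<subseteq> {..<3 * 2 ^ k}" if "2 \<le> i" "i < 2 * N" for i
    using tree_triangle_le[OF that(1)] that(2) \<open>2 * N \<le> 3 * 2 ^ k\<close> by force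
  have "\<exists>s'\<in>(core_step ^^ j) T. s' \<noteq> g ` tree_triangle i \<and> e \<subseteq> s'"
    if e: "e \<subseteq> g ` tree_triangle i" "card e = 2" for e
  proof -
    obtain e' where e': "e' \<subseteq> tree_triangle i" "e = g ` e'" using e(1) by (meson subset_imageE)
    have "inj_on g e'" using e'(1) V[of i] i by (intro inj_on_subset[OF inj]) auto
    then have "card e' = 2" using e(2) e'(2) by (simp add: card_image)
    then obtain h where h: "2 \<le> h" "h \<le> 2 * i + 1" "h \<noteq> i" "e' \<subseteq> tree_triangle h"
      using tree_triangle_neighbour[OF i(1) e'(1)] by blast
    have hN: "h < 2 * N" using h(2) i(2) by simp
    have "tree_triangle h \<noteq> tree_triangle i"
      using inj_onD[OF inj_on_tree_triangle, of h i] h i by auto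
    then have "g ` tree_triangle h \<noteq> g ` tree_triangle i"
      using inj_on_image_eq_iff[OF inj V[of h] V[of i]] h(1) hN i by simp
    moreover have "e \<subseteq> g ` tree_triangle h" unfolding e'(2) using h(4) by (rule image_mono)
    ultimately show ?thesis using IH[OF h(1) hN] by metis
  qed
  moreover have "g ` tree_triangle i \<in> (core_step ^^ j) T" using IH[of i] i by simp
  ultimately show ?case
    unfolding funpow.simps comp_apply core_step_def[of "(core_step ^^ j) T"] by blast
qed

lemma core_step_nonempty_if_tree:
  assumes "inj_on g {..<3 * 2 ^ k}" "(\<lambda>i. g ` tree_triangle i) ` {2..<3 * 2 ^ k} \<subseteq> T"
  shows "(core_step ^^ k) T \<noteq> {}"
  using tree_survives_core_step[OF assms, of k 2] by auto

text \<open>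
  The two vertices of the gluing edge of the first triangle inside \<open>A\<close> are not themselves apices
  of triangles inside \<open>A\<close>.
\<close>

lemma card_tree_triangles_inside:
  assumes "finite A" and ne: "{i. 2 \<le> i \<and> tree_triangle i \<subseteq> A} \<noteq> {}"
  shows "card {i. 2 \<le> i \<and> tree_triangle i \<subseteq> A} + 2 \<le> card A"
proof -
  let ?I = "{i. 2 \<le> i \<and> tree_triangle i \<subseteq> A}"
  define m where "m = (LEAST i. i \<in> ?I)"
  have m: "m \<in> ?I" using ne unfolding m_def by (metis LeastI ex_in_conv)
  have min: "m \<le> i" if "i \<in> ?I" for i using that unfolding m_def by (rule Least_le)
  let ?e = "{fst (attach m), snd (attach m)}"
  have sub: "?I \<subseteq> A" by (auto simp: tree_triangle_def)
  have "?e \<subseteq> A" using m by (auto simp: tree_triangle_def)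
  have lt: "fst (attach m) < snd (attach m)" "snd (attach m) < m" using attach_less m by auto
  then have "?e \<inter> ?I = {}" using min by fastforce
  then have "card (?I \<union> ?e) = card ?I + card ?e"
    using sub \<open>finite A\<close> finite_subset by (intro card_Un_disjoint) auto
  moreover have "card ?e = 2" using lt by simp
  moreover have "card (?I \<union> ?e) \<le> card A"
    using sub \<open>?e \<subseteq> A\<close> \<open>finite A\<close> by (intro card_mono) auto
  ultimately show ?thesis by simp
qed


section \<open>Moment bounds for random subsets\<close>

definition subset_weight :: "'a set \<Rightarrow> real \<Rightarrow> 'a set \<Rightarrow> real" where
  "subset_weight A p T = p ^ card T * (1 - p) ^ (card A - card T)"

lemma subset_weight_nonneg: "0 \<le> p \<Longrightarrow> p \<le> 1 \<Longrightarrow> 0 \<le> subset_weight A p T"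
  by (simp add: subset_weight_def)

lemma sum_subset_weight_superset:
  assumes "finite A" "S \<subseteq> A"
  shows "(\<Sum>T | T \<subseteq> A \<and> S \<subseteq> T. subset_weight A p T) = p ^ card S"
proof -
  have fin: "finite S" using assms finite_subset by blast
  have "(\<Sum>T | T \<subseteq> A \<and> S \<subseteq> T. subset_weight A p T) =
      (\<Sum>B\<in>Pow (A - S). p ^ card S * (p ^ card B * (1 - p) ^ (card (A - S) - card B)))"
  proof (rule sum.reindex_bij_witness[of _ "\<lambda>B. S \<union> B" "\<lambda>T. T - S"])
    fix T assume T: "T \<in> {T. T \<subseteq> A \<and> S \<subseteq> T}"
    then have "card T = card S + card (T - S)" "card A = card S + card (A - S)"
      using assms fin finite_subset[of T A] card_mono[of T S] card_mono[of A S]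
      by (simp_all add: card_Diff_subset)
    then show "p ^ card S * (p ^ card (T - S) * (1 - p) ^ (card (A - S) - card (T - S))) =
        subset_weight A p T"
      by (simp add: subset_weight_def power_add mult.assoc)
  qed (use assms in auto)
  also have "\<dots> = p ^ card S"
    using sum_Pow_binomial[of "A - S" p "1 - p"] assms by (simp flip: sum_distrib_left)
  finally show ?thesis .
qed

lemma sum_subset_weight_of_bool:
  assumes "finite A" "S \<subseteq> A"
  shows "(\<Sum>T | T \<subseteq> A. subset_weight A p T * of_bool (S \<subseteq> T)) = p ^ card S"
proof -
  have "(\<Sum>T | T \<subseteq> A. subset_weight A p T * of_bool (S \<subseteq> T)) =
      (\<Sum>T | T \<subseteq> A \<and> S \<subseteq> T. subset_weight A p T)"
    using \<open>finite A\<close> by (intro sum.mono_neutral_cong_right) auto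
  then show ?thesis using sum_subset_weight_superset[OF assms] by simp
qed

lemma sum_subset_weight:
  assumes "finite A"
  shows "(\<Sum>T | T \<subseteq> A. subset_weight A p T) = 1"
  using sum_subset_weight_superset[OF assms, of "{}"] by simp

lemma prob_lm_model:
  assumes "0 \<le> p" "p \<le> 1"
  shows "\<P>(Y in lm_model n p. P (simplices 2 Y)) =
    (\<Sum>T | T \<subseteq> simplices 2 (full_simplex n) \<and> P T. subset_weight (simplices 2 (full_simplex n)) p T)"
proof -
  let ?D = "simplices 2 (full_simplex n)"
  have "\<P>(Y in lm_model n p. P (simplices 2 Y)) =
      (\<Sum>Y | Y \<in> lm_complexes n \<and> P (simplices 2 Y). subset_weight ?D p (simplices 2 Y))"
    unfolding lm_model_def subset_weight_def card_triangles_full_simplex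
    using assms by (subst measure_point_measure_finite_if)
      (auto simp: space_point_measure finite_lm_complexes)
  also have "\<dots> = (\<Sum>T | T \<in> Pow ?D \<and> P T. subset_weight ?D p T)"
  proof (rule sum.reindex_bij_betw)
    show "bij_betw (simplices 2) {Y \<in> lm_complexes n. P (simplices 2 Y)} {T \<in> Pow ?D. P T}"
    proof (rule bij_betw_subset[OF bij_betw_lm_complexes[of n]])
      show "simplices 2 ` {Y \<in> lm_complexes n. P (simplices 2 Y)} = {T \<in> Pow ?D. P T}"
        unfolding bij_betw_imp_surj_on[OF bij_betw_lm_complexes[of n], symmetric] by auto
    qed auto
  qed
  finally show ?thesis by simp
qed

lemma finite_triangles_full_simplex: "finite (simplices 2 (full_simplex n))"
  by (simp add: simplices_def finite_full_simplex)

lemma collapsible_to_graph_lm_iff: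
  assumes "Y \<in> lm_complexes n"
  shows "collapsible_to_graph k Y \<longleftrightarrow> (core_step ^^ k) (simplices 2 Y) = {}"
  using assms
  by (intro collapsible_to_graph_iff_core_step) (auto simp: lm_complexes_def skeleton_def)

lemma sum_subset_weight_le_union_bound:
  fixes S :: "'i \<Rightarrow> 'a set"
  assumes "finite A" "0 \<le> p" "p \<le> 1" "finite I" and S: "\<And>i. i \<in> I \<Longrightarrow> S i \<subseteq> A"
    and some: "\<And>T. T \<subseteq> A \<Longrightarrow> P T \<Longrightarrow> \<exists>i\<in>I. S i \<subseteq> T"
  shows "(\<Sum>T | T \<subseteq> A \<and> P T. subset_weight A p T) \<le> (\<Sum>i\<in>I. p ^ card (S i))"
proof -
  have "(\<Sum>T | T \<subseteq> A \<and> P T. subset_weight A p T) \<le>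
      (\<Sum>T | T \<subseteq> A \<and> P T. \<Sum>i\<in>I. subset_weight A p T * of_bool (S i \<subseteq> T))"
  proof (rule sum_mono)
    fix T assume T: "T \<in> {T. T \<subseteq> A \<and> P T}"
    then obtain i where "i \<in> I" "S i \<subseteq> T" using some by blast
    then show "subset_weight A p T \<le> (\<Sum>i\<in>I. subset_weight A p T * of_bool (S i \<subseteq> T))"
      using member_le_sum[of i I "\<lambda>i. subset_weight A p T * of_bool (S i \<subseteq> T)"] assms(2-4)
      by (simp add: subset_weight_nonneg)
  qed
  also have "\<dots> \<le> (\<Sum>T | T \<subseteq> A. \<Sum>i\<in>I. subset_weight A p T * of_bool (S i \<subseteq> T))"
    using \<open>finite A\<close> assms(2,3)
    by (intro sum_mono2 sum_nonneg) (auto simp: subset_weight_nonneg)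
  also have "\<dots> = (\<Sum>i\<in>I. p ^ card (S i))"
    using S \<open>finite A\<close>
    by (subst sum.swap) (intro sum.cong refl sum_subset_weight_of_bool, auto)
  finally show ?thesis .
qed

lemma sum_subset_weight_le_second_moment:
  fixes S :: "'i \<Rightarrow> 'a set"
  assumes "finite A" "0 < p" "p \<le> 1" "finite I" "I \<noteq> {}"
    and S: "\<And>i. i \<in> I \<Longrightarrow> S i \<subseteq> A"
    and none: "\<And>T i. T \<subseteq> A \<Longrightarrow> P T \<Longrightarrow> i \<in> I \<Longrightarrow> \<not> S i \<subseteq> T"
  shows "(\<Sum>T | T \<subseteq> A \<and> P T. subset_weight A p T) \<le>
    (\<Sum>i\<in>I. \<Sum>j\<in>I. p ^ card (S i \<union> S j)) / (\<Sum>i\<in>I. p ^ card (S i))\<^sup>2 - 1"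
proof -
  define w where "w = subset_weight A p"
  define X where "X T = (\<Sum>i\<in>I. of_bool (S i \<subseteq> T) :: real)" for T
  define \<mu> where "\<mu> = (\<Sum>i\<in>I. p ^ card (S i))"
  have "\<mu> > 0" unfolding \<mu>_def using assms by (intro sum_pos) auto
  have w0: "0 \<le> w T" for T using assms by (simp add: w_def subset_weight_nonneg)
  have w: "(\<Sum>T | T \<subseteq> A. w T * of_bool (B \<subseteq> T)) = p ^ card B" if "B \<subseteq> A" for B
    unfolding w_def using \<open>finite A\<close> that by (rule sum_subset_weight_of_bool)
  have EX: "(\<Sum>T | T \<subseteq> A. w T * X T) = \<mu>"
    unfolding X_def \<mu>_def sum_distrib_left by (subst sum.swap) (simp add: w S)
  have EXX: "(\<Sum>T | T \<subseteq> A. w T * (X T)\<^sup>2) = (\<Sum>i\<in>I. \<Sum>j\<in>I. p ^ card (S i \<union> S j))"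
  proof -
    have "(X T)\<^sup>2 = (\<Sum>i\<in>I. \<Sum>j\<in>I. of_bool (S i \<union> S j \<subseteq> T))" for T
      unfolding X_def power2_eq_square sum_product by (intro sum.cong refl) auto
    then have "(\<Sum>T | T \<subseteq> A. w T * (X T)\<^sup>2) =
        (\<Sum>T | T \<subseteq> A. \<Sum>i\<in>I. \<Sum>j\<in>I. w T * of_bool (S i \<union> S j \<subseteq> T))"
      by (simp add: sum_distrib_left)
    also have "\<dots> = (\<Sum>i\<in>I. \<Sum>j\<in>I. \<Sum>T | T \<subseteq> A. w T * of_bool (S i \<union> S j \<subseteq> T))"
      by (subst sum.swap, intro sum.cong refl, subst sum.swap) simp
    also have "\<dots> = (\<Sum>i\<in>I. \<Sum>j\<in>I. p ^ card (S i \<union> S j))"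
      using S by (intro sum.cong refl w) auto
    finally show ?thesis .
  qed
  have "\<mu>\<^sup>2 * (\<Sum>T | T \<subseteq> A \<and> P T. w T) = (\<Sum>T | T \<subseteq> A \<and> P T. w T * (X T - \<mu>)\<^sup>2)"
    unfolding sum_distrib_left using none by (intro sum.cong refl) (simp add: X_def)
  also have "\<dots> \<le> (\<Sum>T | T \<subseteq> A. w T * (X T - \<mu>)\<^sup>2)"
    using \<open>finite A\<close> w0 by (intro sum_mono2) auto
  also have "\<dots> = (\<Sum>T | T \<subseteq> A. w T * (X T)\<^sup>2 - 2 * \<mu> * (w T * X T) + \<mu>\<^sup>2 * w T)"
    by (intro sum.cong refl) (simp add: power2_eq_square algebra_simps)
  also have "\<dots> = (\<Sum>T | T \<subseteq> A. w T * (X T)\<^sup>2) - 2 * \<mu> * \<mu> + \<mu>\<^sup>2 * 1"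
    using sum_subset_weight[OF \<open>finite A\<close>, of p]
    by (simp add: sum.distrib sum_subtractf EX flip: sum_distrib_left w_def)
  finally have "\<mu>\<^sup>2 * (\<Sum>T | T \<subseteq> A \<and> P T. w T) \<le> (\<Sum>i\<in>I. \<Sum>j\<in>I. p ^ card (S i \<union> S j)) - \<mu>\<^sup>2"
    unfolding EXX by (simp add: power2_eq_square)
  then show ?thesis
    using \<open>\<mu> > 0\<close> unfolding w_def \<mu>_def[symmetric]
    by (simp add: field_simps)
qed

lemma lm_aasI:
  assumes p: "\<And>n. n \<ge> 1 \<Longrightarrow> 0 < p n \<and> p n < 1"
    and le: "\<forall>\<^sub>F n in sequentially. \<P>(Y in lm_model n (p n). \<not> P Y) \<le> b n"
    and "b \<longlonglongrightarrow> 0"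
  shows "lm_aas p P"
proof -
  have neg: "\<P>(Y in lm_model n (p n). P Y) = 1 - \<P>(Y in lm_model n (p n). \<not> P Y)"
    if "n \<ge> 1" for n
  proof -
    interpret prob_space "lm_model n (p n)"
      using p[OF that] by (intro prob_space_lm_model) auto
    show ?thesis
      using prob_neg[of P] by (simp add: Collect_conj_eq Int_def[symmetric])
  qed
  have "(\<lambda>n. 1 - \<P>(Y in lm_model n (p n). \<not> P Y)) \<longlonglongrightarrow> 1 - 0"
    using le by (intro tendsto_diff tendsto_const tendsto_sandwich[OF _ _ tendsto_const \<open>b \<longlonglongrightarrow> 0\<close>])
      auto
  moreover have "\<forall>\<^sub>F n in sequentially.
      1 - \<P>(Y in lm_model n (p n). \<not> P Y) = \<P>(Y in lm_model n (p n). P Y)"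
    using eventually_ge_at_top[of 1] by eventually_elim (rule neg[symmetric])
  ultimately show ?thesis
    unfolding lm_aas_def by (simp only: diff_zero Lim_transform_eventually)
qed


section \<open>Below the threshold\<close>

lemma card_families_le:
  assumes "v \<le> n"
  shows "finite {S. S \<subseteq> Pow {1..n} \<and> card (\<Union>S) \<le> v}"
    "card {S. S \<subseteq> Pow {1..n} \<and> card (\<Union>S) \<le> v} \<le> 2 ^ 2 ^ v * n ^ v"
proof -
  show "finite {S. S \<subseteq> Pow {1..n} \<and> card (\<Union>S) \<le> v}" by simp
  let ?U = "{U. U \<subseteq> {1..n} \<and> card U = v}"
  have "{S. S \<subseteq> Pow {1..n} \<and> card (\<Union>S) \<le> v} \<subseteq> (\<Union>U\<in>?U. Pow (Pow U))"
  proof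
    fix S assume "S \<in> {S. S \<subseteq> Pow {1..n} \<and> card (\<Union>S) \<le> v}"
    then obtain U where "\<Union>S \<subseteq> U" "U \<subseteq> {1..n}" "card U = v"
      using exists_subset_between[of "\<Union>S" v "{1..n}"] assms by auto
    then show "S \<in> (\<Union>U\<in>?U. Pow (Pow U))" by auto
  qed
  moreover have "finite (\<Union>U\<in>?U. Pow (Pow U))"
    by (rule finite_subset[of _ "Pow (Pow {1..n})"]) auto
  ultimately have "card {S. S \<subseteq> Pow {1..n} \<and> card (\<Union>S) \<le> v} \<le> card (\<Union>U\<in>?U. Pow (Pow U))"
    by (intro card_mono)
  also have "\<dots> \<le> (\<Sum>U\<in>?U. card (Pow (Pow U)))"
    by (rule card_UN_le) simp
  also have "\<dots> = (\<Sum>U\<in>?U. 2 ^ 2 ^ v)"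
  proof (intro sum.cong refl)
    fix U assume "U \<in> ?U"
    then have "finite U" "card U = v" by (auto intro: finite_subset)
    then show "card (Pow (Pow U)) = 2 ^ 2 ^ v" by (simp add: card_Pow)
  qed
  also have "\<dots> = (n choose v) * 2 ^ 2 ^ v" using n_subsets[of "{1..n}" v] by simp
  also have "\<dots> \<le> 2 ^ 2 ^ v * n ^ v" using binomial_le_pow[OF assms] by simp
  finally show "card {S. S \<subseteq> Pow {1..n} \<and> card (\<Union>S) \<le> v} \<le> 2 ^ 2 ^ v * n ^ v" .
qed

lemma powr_power_bounds:
  fixes p a :: real and n v f :: nat
  assumes "n \<ge> 1" "p > 0"
  shows "real v \<le> real f * a \<Longrightarrow> real n ^ v * p ^ f \<le> (p / real n powr - a) ^ f"
    and "real f * a \<le> real v \<Longrightarrow> 1 / (real n ^ v * p ^ f) \<le> (real n powr - a / p) ^ f"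
proof -
  have n: "real n ^ v = real n powr real v" "(real n powr a) ^ f = real n powr (real f * a)"
    using assms by (simp_all add: powr_realpow powr_power mult.commute)
  have eq1: "(p / real n powr - a) ^ f = (real n powr a) ^ f * p ^ f"
    by (simp add: powr_minus field_simps power_mult_distrib)
  have eq2: "(real n powr - a / p) ^ f = 1 / ((real n powr a) ^ f * p ^ f)"
    by (simp add: powr_minus field_simps power_mult_distrib)
  show "real n ^ v * p ^ f \<le> (p / real n powr - a) ^ f" if "real v \<le> real f * a"
    unfolding eq1 n using that assms by (intro mult_right_mono powr_mono) auto
  show "1 / (real n ^ v * p ^ f) \<le> (real n powr - a / p) ^ f" if "real f * a \<le> real v"
    unfolding eq2 n using that assms by (intro divide_left_mono mult_right_mono powr_mono) auto
qed

lemma lm_aas_collapsible: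
  assumes p: "\<And>n. n \<ge> 1 \<Longrightarrow> 0 < p n \<and> p n < 1"
    and less: "much_less p (\<lambda>n. real n powr (- 1 - 2 / (real k + 1)))"
  shows "lm_aas p (collapsible_to_graph k)"
proof (rule lm_aasI[OF p])
  define J where "J = insert (k + 1, k + 3) ((\<lambda>f. (f, f)) ` {1..k})"
  define a where "a = 1 + 2 / (real k + 1)"
  define r where "r n = p n / real n powr - a" for n
  define b where "b n = (\<Sum>(f, v)\<in>J. 2 ^ 2 ^ v * r n ^ f)" for n
  have J: "finite J" "(f, v) \<in> J \<Longrightarrow> 1 \<le> f \<and> v \<le> k + 3 \<and> real v \<le> real f * a" for f v
    by (auto simp: J_def a_def field_simps)
  have "r \<longlonglongrightarrow> 0" using less by (simp add: much_less_def r_def[abs_def] a_def)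
  then show "b \<longlonglongrightarrow> 0"
    unfolding b_def
    by (intro tendsto_null_sum)
      (auto dest!: J(2) intro!: tendsto_mult_right_zero tendsto_null_power)
  show "\<forall>\<^sub>F n in sequentially. \<P>(Y in lm_model n (p n). \<not> collapsible_to_graph k Y) \<le> b n"
    using eventually_ge_at_top[of "k + 3"]
  proof eventually_elim
    fix n assume n: "k + 3 \<le> n"
    let ?D = "simplices 2 (full_simplex n)"
    let ?P = "\<lambda>T. (core_step ^^ k) T \<noteq> {}"
    define G where "G = (\<lambda>(f, v). {S. S \<subseteq> ?D \<and> card S = f \<and> card (\<Union>S) \<le> v})"
    have p: "0 < p n" "p n < 1" using p[of n] n by auto
    have D3: "\<forall>s\<in>?D. card s = 3" by (simp add: simplices_def)
    have D: "?D \<subseteq> Pow {1..n}" by (auto simp: simplices_def full_simplex_def)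
    have finG: "finite (G j)" for j
      using finite_triangles_full_simplex[of n] by (auto simp: G_def split: prod.splits)
    have "{Y \<in> space (lm_model n (p n)). \<not> collapsible_to_graph k Y} =
        {Y \<in> space (lm_model n (p n)). ?P (simplices 2 Y)}"
      by (auto simp: collapsible_to_graph_lm_iff)
    then have "\<P>(Y in lm_model n (p n). \<not> collapsible_to_graph k Y) =
        (\<Sum>T | T \<subseteq> ?D \<and> ?P T. subset_weight ?D (p n) T)"
      using prob_lm_model[of "p n" n ?P] p by simp
    also have "\<dots> \<le> (\<Sum>i\<in>Sigma J G. p n ^ card (snd i))"
    proof (rule sum_subset_weight_le_union_bound)
      show "finite (Sigma J G)" using J(1) finG by auto
      fix T assume T: "T \<subseteq> ?D" "?P T"
      then have "finite T" "\<forall>s\<in>T. card s = 3"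
        using finite_subset[OF _ finite_triangles_full_simplex] D3 by auto
      from dense_subset_if_core_step_nonempty[OF this T(2)]
      obtain S where S: "S \<subseteq> T" "card S = k + 1 \<and> card (\<Union>S) \<le> k + 3 \<or>
        1 \<le> card S \<and> card S \<le> k \<and> card (\<Union>S) \<le> card S" by blast
      then have "(card S, k + 3) \<in> J \<and> card (\<Union>S) \<le> k + 3 \<or>
          (card S, card S) \<in> J \<and> card (\<Union>S) \<le> card S"
        by (auto simp: J_def)
      then obtain v where "(card S, v) \<in> J" "card (\<Union>S) \<le> v" by blast
      then have "((card S, v), S) \<in> Sigma J G" using S(1) T(1) by (auto simp: G_def)
      then show "\<exists>i\<in>Sigma J G. snd i \<subseteq> T"
        using S(1) by (intro bexI[of _ "((card S, v), S)"]) simp_all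
    qed (use p finite_triangles_full_simplex in \<open>auto simp: G_def\<close>)
    also have "\<dots> = (\<Sum>j\<in>J. \<Sum>S\<in>G j. p n ^ card S)"
      using J(1) finG by (subst sum.Sigma) (auto simp: case_prod_unfold)
    also have "\<dots> \<le> b n"
      unfolding b_def
    proof (rule sum_mono, clarify)
      fix f v assume fv: "(f, v) \<in> J"
      have "(\<Sum>S\<in>G (f, v). p n ^ card S) = real (card (G (f, v))) * p n ^ f"
        by (simp add: G_def)
      also have "card (G (f, v)) \<le> card {S. S \<subseteq> Pow {1..n} \<and> card (\<Union>S) \<le> v}"
        using D by (intro card_mono) (auto simp: G_def)
      then have "card (G (f, v)) \<le> 2 ^ 2 ^ v * n ^ v"
        using card_families_le(2)[of v n] J(2)[OF fv] n by linarith
      then have "real (card (G (f, v))) \<le> 2 ^ 2 ^ v * real n ^ v"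
        by (simp flip: of_nat_le_iff[where 'a = real])
      then have "real (card (G (f, v))) * p n ^ f \<le> 2 ^ 2 ^ v * (real n ^ v * p n ^ f)"
        using p by (simp flip: mult.assoc add: mult_right_mono)
      also have "\<dots> \<le> 2 ^ 2 ^ v * r n ^ f"
        unfolding r_def using powr_power_bounds(1)[of n "p n" v f a] J(2)[OF fv] n p
        by (intro mult_left_mono) auto
      finally show "(\<Sum>S\<in>G (f, v). p n ^ card S) \<le> 2 ^ 2 ^ v * r n ^ f" .
    qed
    finally show "\<P>(Y in lm_model n (p n). \<not> collapsible_to_graph k Y) \<le> b n" .
  qed
qed


section \<open>Above the threshold\<close>

text \<open>
  The tree vertex \<open>x < N\<close> is sent into the residue class of \<open>x + 1\<close> modulo \<open>N\<close>. Thus every \<open>\<phi>\<close> gives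
  an embedding, and a triangle shared by two copies is the same tree triangle, on which both
  maps agree.
\<close>

definition block_map :: "nat \<Rightarrow> (nat \<Rightarrow> nat) \<Rightarrow> nat \<Rightarrow> nat" where
  "block_map N \<phi> x = \<phi> x * N + x + 1"

definition tree_copy :: "nat \<Rightarrow> (nat \<Rightarrow> nat) \<Rightarrow> nat set set" where
  "tree_copy N \<phi> = (\<lambda>i. block_map N \<phi> ` tree_triangle i) ` {2..<N}"

lemma block_map_eqD:
  assumes "block_map N \<phi> x = block_map N \<psi> y" "x < N" "y < N"
  shows "x = y" "\<phi> x = \<psi> y"
proof -
  have "(\<phi> x * N + x) mod N = (\<psi> y * N + y) mod N" "(\<phi> x * N + x) div N = (\<psi> y * N + y) div N"
    using assms(1) by (simp_all add: block_map_def)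
  then show "x = y" "\<phi> x = \<psi> y" using assms(2,3) by simp_all
qed

lemma inj_on_block_map: "inj_on (block_map N \<phi>) {..<N}"
  by (rule inj_onI) (auto dest: block_map_eqD)

lemma tree_triangle_subset: "i \<in> {2..<N} \<Longrightarrow> tree_triangle i \<subseteq> {..<N}"
  using tree_triangle_le[of i] by force

lemma block_map_image_eqD:
  assumes "block_map N \<phi> ` A = block_map N \<psi> ` B" "A \<subseteq> {..<N}" "B \<subseteq> {..<N}"
  shows "A = B" "A \<subseteq> {x \<in> {..<N}. \<phi> x = \<psi> x}"
proof -
  have sub: "x \<in> B \<and> \<phi> x = \<psi> x" if x: "x \<in> A"
    and *: "block_map N \<phi> ` A = block_map N \<psi> ` B" "A \<subseteq> {..<N}" "B \<subseteq> {..<N}" for x A B \<phi> \<psi>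
  proof -
    obtain y where y: "y \<in> B" "block_map N \<phi> x = block_map N \<psi> y"
      using x *(1) by (metis imageE imageI)
    then show ?thesis using block_map_eqD[OF y(2)] x *(2,3) by auto
  qed
  show "A = B" using sub[OF _ assms] sub[OF _ assms(1)[symmetric] assms(3,2)] by blast
  show "A \<subseteq> {x \<in> {..<N}. \<phi> x = \<psi> x}" using sub[OF _ assms] assms(2) by blast
qed

lemma card_tree_copy: "card (tree_copy N \<phi>) = N - 2"
proof -
  have "inj_on (\<lambda>i. block_map N \<phi> ` tree_triangle i) {2..<N}"
  proof (rule inj_onI)
    fix i j assume ij: "i \<in> {2..<N}" "j \<in> {2..<N}"
      "block_map N \<phi> ` tree_triangle i = block_map N \<phi> ` tree_triangle j"
    then have "tree_triangle i = tree_triangle j"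
      using block_map_image_eqD(1)[OF ij(3)] tree_triangle_subset by blast
    then show "i = j" using inj_onD[OF inj_on_tree_triangle] ij by simp
  qed
  then show ?thesis unfolding tree_copy_def by (simp add: card_image)
qed

lemma tree_copy_subset_triangles:
  assumes \<phi>: "\<phi> \<in> {..<N} \<rightarrow>\<^sub>E {..<m}" and "m * N \<le> n"
  shows "tree_copy N \<phi> \<subseteq> simplices 2 (full_simplex n)"
proof -
  have "block_map N \<phi> x \<in> {1..n}" if "x < N" for x
  proof -
    have "\<phi> x < m" using \<phi> that by auto
    then have "Suc (\<phi> x) * N \<le> m * N" by (intro mult_right_mono) auto
    then show ?thesis using that \<open>m * N \<le> n\<close> by (simp add: block_map_def)
  qed
  moreover have "card (block_map N \<phi> ` tree_triangle i) = 3" if "i \<in> {2..<N}" for i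
    using card_image[OF inj_on_subset[OF inj_on_block_map tree_triangle_subset[OF that]]]
      card_tree_triangle[of i] that by simp
  ultimately show ?thesis
    unfolding tree_copy_def simplices_def full_simplex_def
    using tree_triangle_subset by (fastforce simp: tree_triangle_def)
qed

abbreviation tree_count :: "nat set \<Rightarrow> nat" where
  "tree_count A \<equiv> card {i. 2 \<le> i \<and> tree_triangle i \<subseteq> A}"

lemma finite_trees_inside: "finite A \<Longrightarrow> finite {i. 2 \<le> i \<and> tree_triangle i \<subseteq> A}"
  by (rule finite_subset[of _ A]) (auto simp: tree_triangle_def)

lemma card_tree_copy_Un:
  "2 * (N - 2) \<le> card (tree_copy N \<phi> \<union> tree_copy N \<psi>) + tree_count {x \<in> {..<N}. \<phi> x = \<psi> x}"
proof -
  let ?I = "{i. 2 \<le> i \<and> tree_triangle i \<subseteq> {x \<in> {..<N}. \<phi> x = \<psi> x}}"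
  have fin: "finite ?I" by (rule finite_trees_inside) simp
  have "tree_copy N \<phi> \<inter> tree_copy N \<psi> \<subseteq> (\<lambda>i. block_map N \<phi> ` tree_triangle i) ` ?I"
  proof
    fix s assume s: "s \<in> tree_copy N \<phi> \<inter> tree_copy N \<psi>"
    then obtain i j where ij: "i \<in> {2..<N}" "s = block_map N \<phi> ` tree_triangle i"
      "j \<in> {2..<N}" "s = block_map N \<psi> ` tree_triangle j"
      unfolding tree_copy_def by auto
    then have "tree_triangle i \<subseteq> {x \<in> {..<N}. \<phi> x = \<psi> x}"
      using block_map_image_eqD(2)[of N \<phi> "tree_triangle i" \<psi> "tree_triangle j"]
        tree_triangle_subset by simp
    then show "s \<in> (\<lambda>i. block_map N \<phi> ` tree_triangle i) ` ?I" using ij by auto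
  qed
  then have "card (tree_copy N \<phi> \<inter> tree_copy N \<psi>) \<le> card ?I"
    using fin by (rule surj_card_le[rotated])
  moreover have "card (tree_copy N \<phi>) + card (tree_copy N \<psi>) =
      card (tree_copy N \<phi> \<union> tree_copy N \<psi>) + card (tree_copy N \<phi> \<inter> tree_copy N \<psi>)"
    by (rule card_Un_Int) (auto simp: tree_copy_def)
  ultimately show ?thesis by (simp add: card_tree_copy)
qed

lemma card_PiE_agreeing:
  assumes "\<phi> \<in> {..<N} \<rightarrow>\<^sub>E {..<m}" "A \<subseteq> {..<N}"
  shows "card {\<psi> \<in> {..<N} \<rightarrow>\<^sub>E {..<m}. \<forall>x\<in>A. \<phi> x = \<psi> x} = m ^ (N - card A)"
proof -
  have "{\<psi> \<in> {..<N} \<rightarrow>\<^sub>E {..<m}. \<forall>x\<in>A. \<phi> x = \<psi> x} =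
      (\<Pi>\<^sub>E x\<in>{..<N}. if x \<in> A then {\<phi> x} else {..<m})"
  proof (intro set_eqI iffI)
    fix \<psi> assume "\<psi> \<in> (\<Pi>\<^sub>E x\<in>{..<N}. if x \<in> A then {\<phi> x} else {..<m})"
    then have ext: "\<psi> \<in> extensional {..<N}"
      and mem: "\<And>x. x < N \<Longrightarrow> \<psi> x \<in> (if x \<in> A then {\<phi> x} else {..<m})"
      by (simp_all add: PiE_iff)
    have "\<phi> x = \<psi> x" if "x \<in> A" for x
      using mem[of x] that assms(2) by (auto split: if_splits)
    moreover have "\<psi> x < m" if "x < N" for x
      using mem[OF that] PiE_mem[OF assms(1), of x] that by (auto split: if_splits)
    ultimately show "\<psi> \<in> {\<psi> \<in> {..<N} \<rightarrow>\<^sub>E {..<m}. \<forall>x\<in>A. \<phi> x = \<psi> x}"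
      using ext by (simp add: PiE_iff)
  qed (auto simp: PiE_iff)
  also have "card \<dots> = (\<Prod>x\<in>{..<N}. if x \<in> A then 1 else m)"
    by (simp add: card_PiE if_distrib cong: if_cong)
  also have "\<dots> = (\<Prod>x\<in>{..<N} - A. m)"
    by (intro prod.mono_neutral_cong_right) auto
  finally show ?thesis
    using assms(2) by (simp add: card_Diff_subset finite_subset)
qed

lemma second_moment_tree_copies:
  fixes p :: real and m N :: nat
  assumes p: "0 < p" "p \<le> 1" and "m > 0"
  defines "I \<equiv> {..<N} \<rightarrow>\<^sub>E {..<m}"
  shows "(\<Sum>\<phi>\<in>I. \<Sum>\<psi>\<in>I. p ^ card (tree_copy N \<phi> \<union> tree_copy N \<psi>)) /
      (\<Sum>\<phi>\<in>I. p ^ card (tree_copy N \<phi>))\<^sup>2 - 1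
    \<le> (\<Sum>A | A \<subseteq> {..<N} \<and> tree_count A \<noteq> 0. 1 / (real m ^ card A * p ^ tree_count A))"
proof -
  define \<A> where "\<A> = {A. A \<subseteq> {..<N} \<and> tree_count A \<noteq> 0}"
  define M where "M = real m ^ N"
  define q where "q = p ^ (N - 2)"
  have pos: "M > 0" "q > 0" using assms by (simp_all add: M_def q_def)
  have fin: "finite I" "finite \<A>" by (simp_all add: I_def \<A>_def finite_PiE)
  have cardI: "real (card I) = M" by (simp add: I_def M_def card_PiE)
  have le: "p ^ card (tree_copy N \<phi> \<union> tree_copy N \<psi>) \<le>
      q\<^sup>2 * (1 + (\<Sum>A\<in>\<A>. of_bool (\<forall>x\<in>A. \<phi> x = \<psi> x) / p ^ tree_count A))" for \<phi> \<psi>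
  proof -
    define A where "A = {x \<in> {..<N}. \<phi> x = \<psi> x}"
    have nn: "0 \<le> of_bool (\<forall>x\<in>B. \<phi> x = \<psi> x) / p ^ tree_count B" for B using p by simp
    have "p ^ (card (tree_copy N \<phi> \<union> tree_copy N \<psi>) + tree_count A) \<le> p ^ (2 * (N - 2))"
      using p card_tree_copy_Un unfolding A_def by (intro power_decreasing) auto
    then have "p ^ card (tree_copy N \<phi> \<union> tree_copy N \<psi>) \<le> q\<^sup>2 * (1 / p ^ tree_count A)"
      using p by (simp add: q_def power_add power_mult power2_eq_square power_mult_distrib
          mult_2 field_simps)
    also have "1 / p ^ tree_count A \<le> 1 + (\<Sum>A\<in>\<A>. of_bool (\<forall>x\<in>A. \<phi> x = \<psi> x) / p ^ tree_count A)"
    proof (cases "tree_count A = 0")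
      case True
      then show ?thesis using sum_nonneg[of \<A>, OF nn] by simp
    next
      case False
      then have "A \<in> \<A>" by (auto simp: \<A>_def A_def)
      then have "of_bool (\<forall>x\<in>A. \<phi> x = \<psi> x) / p ^ tree_count A
          \<le> (\<Sum>A\<in>\<A>. of_bool (\<forall>x\<in>A. \<phi> x = \<psi> x) / p ^ tree_count A)"
        using nn fin(2) by (rule member_le_sum)
      moreover have "\<forall>x\<in>A. \<phi> x = \<psi> x" by (simp add: A_def)
      ultimately show ?thesis by simp
    qed
    finally show ?thesis using pos by simp
  qed
  have pairs: "(\<Sum>\<phi>\<in>I. \<Sum>\<psi>\<in>I. of_bool (\<forall>x\<in>A. \<phi> x = \<psi> x)) = M\<^sup>2 / real m ^ card A"
    if "A \<in> \<A>" for A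
  proof -
    have A: "A \<subseteq> {..<N}" using that by (simp add: \<A>_def)
    have "(\<Sum>\<psi>\<in>I. of_bool (\<forall>x\<in>A. \<phi> x = \<psi> x)) = M / real m ^ card A" if "\<phi> \<in> I" for \<phi>
    proof -
      have "(\<Sum>\<psi>\<in>I. of_bool (\<forall>x\<in>A. \<phi> x = \<psi> x)) = real (card {\<psi> \<in> I. \<forall>x\<in>A. \<phi> x = \<psi> x})"
        using fin by (simp add: Int_def)
      also have "\<dots> = real m ^ (N - card A)"
        using card_PiE_agreeing[of \<phi> N m A] that A unfolding I_def by simp
      also have "\<dots> = M / real m ^ card A"
        using card_mono[OF _ A] \<open>m > 0\<close> by (simp add: M_def power_diff)
      finally show ?thesis .
    qed
    then show ?thesis using cardI by (simp add: power2_eq_square)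
  qed
  have "(\<Sum>\<phi>\<in>I. \<Sum>\<psi>\<in>I. p ^ card (tree_copy N \<phi> \<union> tree_copy N \<psi>)) \<le>
      (\<Sum>\<phi>\<in>I. \<Sum>\<psi>\<in>I. q\<^sup>2 * (1 + (\<Sum>A\<in>\<A>. of_bool (\<forall>x\<in>A. \<phi> x = \<psi> x) / p ^ tree_count A)))"
    by (intro sum_mono le)
  also have "\<dots> = q\<^sup>2 * (M\<^sup>2 +
      (\<Sum>\<phi>\<in>I. \<Sum>\<psi>\<in>I. \<Sum>A\<in>\<A>. of_bool (\<forall>x\<in>A. \<phi> x = \<psi> x) / p ^ tree_count A))"
    using cardI by (simp add: sum.distrib power2_eq_square flip: sum_distrib_left)
  also have "(\<Sum>\<phi>\<in>I. \<Sum>\<psi>\<in>I. \<Sum>A\<in>\<A>. of_bool (\<forall>x\<in>A. \<phi> x = \<psi> x) / p ^ tree_count A) =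
      (\<Sum>A\<in>\<A>. (\<Sum>\<phi>\<in>I. \<Sum>\<psi>\<in>I. of_bool (\<forall>x\<in>A. \<phi> x = \<psi> x)) / p ^ tree_count A)"
    unfolding sum_divide_distrib sum.swap[of _ \<A> I] ..
  also have "\<dots> = M\<^sup>2 * (\<Sum>A\<in>\<A>. 1 / (real m ^ card A * p ^ tree_count A))"
    unfolding sum_distrib_left by (intro sum.cong refl) (simp add: pairs)
  finally have "(\<Sum>\<phi>\<in>I. \<Sum>\<psi>\<in>I. p ^ card (tree_copy N \<phi> \<union> tree_copy N \<psi>)) \<le>
      (M * q)\<^sup>2 * (1 + (\<Sum>A\<in>\<A>. 1 / (real m ^ card A * p ^ tree_count A)))"
    by (simp add: algebra_simps power_mult_distrib)
  moreover have "(\<Sum>\<phi>\<in>I. p ^ card (tree_copy N \<phi>)) = M * q"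
    using cardI by (simp add: card_tree_copy q_def)
  ultimately show ?thesis
    using pos unfolding \<A>_def[symmetric] by (simp add: field_simps)
qed

lemma lm_aas_not_collapsible:
  assumes "k \<ge> 1" and p: "\<And>n. n \<ge> 1 \<Longrightarrow> 0 < p n \<and> p n < 1"
    and less: "much_less (\<lambda>n. real n powr (- 1 - 1 / (3 * 2 ^ (k - 1) - 1))) p"
  shows "lm_aas p (\<lambda>Y. \<not> collapsible_to_graph k Y)"
proof (rule lm_aasI[OF p])
  define N :: nat where "N = 3 * 2 ^ k"
  define a where "a = 1 + 1 / (3 * 2 ^ (k - 1) - 1 :: real)"
  define r where "r n = real n powr - a / p n" for n
  define \<A> where "\<A> = {A. A \<subseteq> {..<N} \<and> tree_count A \<noteq> 0}"
  define b where "b n = (\<Sum>A\<in>\<A>. real (2 * N) ^ card A * r n ^ tree_count A)" for n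
  have N: "N > 0" by (simp add: N_def)
  have A: "real (tree_count A) * a \<le> real (card A)" "tree_count A \<noteq> 0" if "A \<in> \<A>" for A
  proof -
    have sub: "A \<subseteq> {..<N}" "finite A" and ne: "tree_count A \<noteq> 0"
      using that finite_subset[of A "{..<N}"] by (auto simp: \<A>_def)
    have *: "tree_count A + 2 \<le> card A"
      using card_tree_triangles_inside[OF sub(2)] ne by (metis card.empty)
    have N': "real N = 2 * (3 * 2 ^ (k - 1))"
      using \<open>k \<ge> 1\<close> by (cases k) (simp_all add: N_def)
    have "card A \<le> N" using card_mono[OF _ sub(1)] by simp
    then have "real (tree_count A) \<le> 2 * (3 * 2 ^ (k - 1) - 1)"
      using * N' of_nat_mono[of "tree_count A + 2" N, where 'a = real] by simp
    moreover have "(0::real) < 3 * 2 ^ (k - 1) - 1"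
      using one_le_power[of "2 :: real" "k - 1"] by linarith
    ultimately have "real (tree_count A) / (3 * 2 ^ (k - 1) - 1) \<le> 2"
      by (simp only: pos_divide_le_eq)
    then have "real (tree_count A) * a \<le> real (tree_count A) + 2"
      by (simp add: a_def distrib_left)
    then show "real (tree_count A) * a \<le> real (card A)" using * by linarith
    show "tree_count A \<noteq> 0" by (rule ne)
  qed
  have "r \<longlonglongrightarrow> 0" using less by (simp add: much_less_def r_def[abs_def] a_def)
  then show "b \<longlonglongrightarrow> 0"
    unfolding b_def using A(2)
    by (intro tendsto_null_sum tendsto_mult_right_zero tendsto_null_power) auto
  show "\<forall>\<^sub>F n in sequentially. \<P>(Y in lm_model n (p n). \<not> \<not> collapsible_to_graph k Y) \<le> b n"
    using eventually_ge_at_top[of N]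
  proof eventually_elim
    fix n assume n: "N \<le> n"
    define m where "m = n div N"
    let ?D = "simplices 2 (full_simplex n)"
    let ?P = "\<lambda>T. (core_step ^^ k) T = {}"
    let ?I = "{..<N} \<rightarrow>\<^sub>E {..<m}"
    have p: "0 < p n" "p n < 1" using p[of n] n N by auto
    have m: "m > 0" "m * N \<le> n" "n < (m + 1) * N"
      using n N by (auto simp: m_def div_greater_zero_iff dividend_less_div_times)
    have "{Y \<in> space (lm_model n (p n)). \<not> \<not> collapsible_to_graph k Y} =
        {Y \<in> space (lm_model n (p n)). ?P (simplices 2 Y)}"
      by (auto simp: collapsible_to_graph_lm_iff)
    then have "\<P>(Y in lm_model n (p n). \<not> \<not> collapsible_to_graph k Y) =
        (\<Sum>T | T \<subseteq> ?D \<and> ?P T. subset_weight ?D (p n) T)"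
      using prob_lm_model[of "p n" n ?P] p by simp
    also have "\<dots> \<le> (\<Sum>\<phi>\<in>?I. \<Sum>\<psi>\<in>?I. p n ^ card (tree_copy N \<phi> \<union> tree_copy N \<psi>)) /
        (\<Sum>\<phi>\<in>?I. p n ^ card (tree_copy N \<phi>))\<^sup>2 - 1"
    proof (rule sum_subset_weight_le_second_moment)
      show "?I \<noteq> {}" using m by (auto simp: PiE_eq_empty_iff)
      show "tree_copy N \<phi> \<subseteq> ?D" if "\<phi> \<in> ?I" for \<phi>
        using that m(2) by (rule tree_copy_subset_triangles)
      show "\<not> tree_copy N \<phi> \<subseteq> T" if "?P T" for T \<phi>
        using core_step_nonempty_if_tree[of "block_map N \<phi>" k T] inj_on_block_map that
        by (auto simp: tree_copy_def N_def)
    qed (use p in \<open>auto simp: finite_triangles_full_simplex finite_PiE\<close>)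
    also have "\<dots> \<le> (\<Sum>A\<in>\<A>. 1 / (real m ^ card A * p n ^ tree_count A))"
      unfolding \<A>_def using p m by (intro second_moment_tree_copies) auto
    also have "\<dots> \<le> b n"
      unfolding b_def
    proof (rule sum_mono)
      fix A assume "A \<in> \<A>"
      have "n < (m + m) * N"
        using m(1,3) mult_right_mono[of "m + 1" "m + m" N] by linarith
      then have "real n \<le> real (2 * N) * real m"
        by (simp add: algebra_simps flip: of_nat_mult of_nat_add)
      then have "real n ^ card A \<le> (real (2 * N) * real m) ^ card A"
        by (intro power_mono) auto
      then have "1 / (real m ^ card A * p n ^ tree_count A) \<le>
          real (2 * N) ^ card A * (1 / (real n ^ card A * p n ^ tree_count A))"
        using p m n N by (simp add: field_simps)
      also have "\<dots> \<le> real (2 * N) ^ card A * r n ^ tree_count A"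
        unfolding r_def using powr_power_bounds(2)[of n "p n" "tree_count A" a "card A"]
          A(1)[OF \<open>A \<in> \<A>\<close>] n N p
        by (intro mult_left_mono) auto
      finally show "1 / (real m ^ card A * p n ^ tree_count A) \<le>
          real (2 * N) ^ card A * r n ^ tree_count A" .
    qed
    finally show "\<P>(Y in lm_model n (p n). \<not> \<not> collapsible_to_graph k Y) \<le> b n" .
  qed
qed

theorem theorem1:
  fixes k :: nat and p :: "nat \<Rightarrow> real"
  assumes "k \<ge> 1"
    and "\<And>n. n \<ge> 1 \<Longrightarrow> 0 < p n \<and> p n < 1"
  shows "(much_less p (\<lambda>n. real n powr (- 1 - 2 / (real k + 1)))
           \<longrightarrow> lm_aas p (\<lambda>Y. collapsible_to_graph k Y))
       \<and> (much_less (\<lambda>n. real n powr (- 1 - 1 / (3 * 2 ^ (k - 1) - 1))) p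
           \<longrightarrow> lm_aas p (\<lambda>Y. \<not> collapsible_to_graph k Y))"
  using lm_aas_collapsible[of p k] lm_aas_not_collapsible[of k p] assms by blast

end
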